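(* Let $d\ge1$, let $w\ne0$ and $\alpha$ be complex numbers, and let $\{P_n\}_{n\ge0}$ be a monic $d$-orthogonal polynomial sequence such that, with $Q_n=(n+1)^{-1}\Delta_wP_{n+1}$, $$P_n(x)=Q_n(x)-n\alpha\,Q_{n-1}(x),\qquad n\ge0\quad(Q_{-1}=0).$$ Let $\beta_n,\gamma_n^{k}$ be the recurrence coefficients of $\{P_n\}$. Then, for all integers $0\le k\le d$ and $n\ge k$, \begin{align*} P_{n-k+1}(x)&=\left[x+kw-k\alpha(n-k+2)-\beta_n\right]P_{n-k}(x)\\ &\quad+\sum_{i=1}^{k}\left\{\alpha^i\left[\binom{k}{i}(x+kw+\alpha-\beta_n)-\alpha\binom{k+1}{i+1}(n-k+i+2)\right]\right.\\ &\qquad\left.-\sum_{j=0}^{i-1}\binom{k-1-j}{i-1-j}\alpha^{i-1-j}\frac{\gamma_{n-j}^{d-1-j}}{\langle n\rangle_{j+1}}\right\}\Delta_w^iP_{n-k}(x)\\ &\quad-\sum_{i=k}^{d-1}\frac{\gamma_{n-i}^{d-1-i}}{\langle n\rangle_k}\Delta_w^kP_{n-i-1}(x). \end{align*}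
   Context: $\Delta_wf(x)=\dfrac{f(x+w)-f(x)}{w}$, and $\langle n\rangle_k=n(n-1)\cdots(n-k+1)$, $\langle n\rangle_0=1$, is the falling factorial. Empty sums are $0$. A sequence of monic polynomials $\{P_n\}_{n\ge0}$ with $\deg P_n=n$ (complex coefficients) is a $d$-orthogonal polynomial sequence if there are linear functionals $u_0,\dots,u_{d-1}$ on polynomials such that, for each $0\le r\le d-1$ and all $m\ge0$: $\langle u_r,x^mP_n\rangle=0$ for $n\ge md+r+1$, and $\langle u_r,x^mP_{md+r}\rangle\ne0$. Equivalently (a known analogue of Favard's theorem), $P_0=1$ and $$P_{n+1}(x)=(x-\beta_n)P_n(x)-\sum_{\nu=0}^{d-1}\gamma_{n-\nu}^{d-1-\nu}P_{n-1-\nu}(x),\qquad n\ge0,$$ with $\gamma_m^0\neq0$ for $m\ge1$, and the conventions $P_m=0$ for $m<0$ and $\gamma_m^{k}=0$ for $m\le0$. The superscripts of $\gamma$ are indices, not powers. These $\beta_n,\gamma_n^k$ are the recurrence coefficients. *)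

theory Defs
  imports Complex_Main "HOL-Computational_Algebra.Polynomial"
begin

definition Delta :: "complex \<Rightarrow> complex poly \<Rightarrow> complex poly" where
  "Delta w f = smult (1 / w) (pcompose f [:w, 1:] - f)"

definition falling_factorial :: "nat \<Rightarrow> nat \<Rightarrow> complex" where
  "falling_factorial n k = (\<Prod>i<k. of_nat n - of_nat i)"

text \<open>Extension of a sequence to integer indices, with value 0 at negative ones.\<close>

definition zero_ext :: "(nat \<Rightarrow> 'a::zero) \<Rightarrow> int \<Rightarrow> 'a" where
  "zero_ext S m = (if m < 0 then 0 else S (nat m))"

definition monic_sequence :: "(nat \<Rightarrow> complex poly) \<Rightarrow> bool" where
  "monic_sequence P \<longleftrightarrow> (\<forall>n. degree (P n) = n \<and> lead_coeff (P n) = 1)"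

definition d_orthogonal :: "nat \<Rightarrow> (nat \<Rightarrow> complex poly) \<Rightarrow> bool" where
  "d_orthogonal d P \<longleftrightarrow>
    (\<exists>u :: nat \<Rightarrow> complex poly \<Rightarrow> complex.
      (\<forall>r<d. Vector_Spaces.linear smult (*) (u r)) \<and>
      (\<forall>r<d. \<forall>m.
        (\<forall>n\<ge>m * d + r + 1. u r (monom 1 m * P n) = 0) \<and>
        u r (monom 1 m * P (m * d + r)) \<noteq> 0))"

text \<open>
  \<open>\<gamma> m k\<close> is the coefficient with subscript \<open>m\<close> and superscript \<open>k\<close>. Subscripts are
  integers so that the convention for \<open>m \<le> 0\<close> can be stated.
  Given \<open>P\<close>, the values \<open>\<beta> n\<close> and \<open>\<gamma> m k\<close> with \<open>k < d\<close> are uniquely determined, since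
  the polynomials \<open>P n\<close> have pairwise distinct degrees.
\<close>

definition recurrence_coeffs ::
  "nat \<Rightarrow> (nat \<Rightarrow> complex poly) \<Rightarrow> (nat \<Rightarrow> complex) \<Rightarrow> (int \<Rightarrow> nat \<Rightarrow> complex) \<Rightarrow> bool" where
  "recurrence_coeffs d P \<beta> \<gamma> \<longleftrightarrow>
    P 0 = 1 \<and>
    (\<forall>n. P (n + 1) = [:- \<beta> n, 1:] * P n
        - (\<Sum>\<nu><d. smult (\<gamma> (int n - int \<nu>) (d - 1 - \<nu>)) (zero_ext P (int n - 1 - int \<nu>)))) \<and>
    (\<forall>m\<ge>1. \<gamma> m 0 \<noteq> 0) \<and>
    (\<forall>k<d. \<forall>m\<le>0. \<gamma> m k = 0)"

definition Q_seq :: "complex \<Rightarrow> (nat \<Rightarrow> complex poly) \<Rightarrow> nat \<Rightarrow> complex poly" where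
  "Q_seq w P n = smult (1 / of_nat (n + 1)) (Delta w (P (n + 1)))"

end

theory Submission
  imports Defs
begin

text \<open>
  Put \<open>T = 1 + \<alpha> \<Delta>\<^sub>w\<close>. Since \<open>Q\<^bsub>m-1\<^esub> = \<Delta>\<^sub>w P\<^sub>m / m\<close>, the relation between \<open>P\<close> and \<open>Q\<close> says
  exactly that \<open>\<Delta>\<^sub>w P\<^bsub>m+1\<^esub> = (m + 1) T P\<^sub>m\<close> for all \<open>m\<close>
  (lemma \<open>Delta_Suc_of_Q_seq\<close>). As \<open>T\<close> commutes with \<open>\<Delta>\<^sub>w\<close>, iteration gives
  \<open>\<Delta>\<^sub>w\<^sup>k P\<^bsub>N+k\<^esub> = \<langle>N + k\<rangle>\<^sub>k T\<^sup>k P\<^sub>N\<close>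
  (lemma \<open>Delta_pow_sequence\<close>): a difference lowers the index, and the price is a power of \<open>T\<close>.

  Let \<open>n = N + k\<close>, apply \<open>\<Delta>\<^sub>w\<^sup>k\<close> to the recurrence for \<open>P\<^bsub>n+1\<^esub>\<close> and divide by \<open>\<langle>n\<rangle>\<^sub>k\<close>.
  The commutator of \<open>\<Delta>\<^sub>w\<^sup>k\<close> with multiplication by \<open>x\<close> produces the terms \<open>k w\<close> and
  \<open>k \<Delta>\<^sub>w\<^bsup>k-1\<^esup> P\<^sub>n\<close>; the latter, together with \<open>\<langle>n + 1\<rangle>\<^sub>k - \<langle>n\<rangle>\<^sub>k = k \<langle>n\<rangle>\<^bsub>k-1\<^esub>\<close>,
  collapses to \<open>- k \<alpha> T\<^sup>k P\<^sub>N\<close> (lemma \<open>differenced_recurrence\<close>):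
  \<open>T\<^sup>k P\<^bsub>N+1\<^esub> = (x + k w - k \<alpha> - \<beta>\<^sub>n) T\<^sup>k P\<^sub>N - \<langle>n\<rangle>\<^sub>k\<^sup>-\<^sup>1 \<Delta>\<^sub>w\<^sup>k R\<close>,
  where \<open>R\<close> is the \<open>\<gamma>\<close>-part of the recurrence.

  On the left, telescoping gives
  \<open>T\<^sup>k P\<^bsub>N+1\<^esub> = P\<^bsub>N+1\<^esub> + (N + 1) \<alpha> (T + \<dots> + T\<^sup>k) P\<^sub>N\<close>. Expanding all powers of
  \<open>T\<close> by the binomial theorem then yields the coefficients that do not involve \<open>\<gamma>\<close>
  (lemma \<open>one_plus_Delta_pow_coefficients\<close>). In \<open>\<Delta>\<^sub>w\<^sup>k R\<close>, a term \<open>P\<^bsub>n-1-j\<^esub>\<close> with \<open>j < k\<close> has index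
  \<open>N + (k - 1 - j)\<close>, so that \<open>k - 1 - j\<close> of the differences bring it down to \<open>P\<^sub>N\<close>; the terms with
  \<open>j \<ge> k\<close> lie below \<open>P\<^sub>N\<close> already and stay as they are.
\<close>

section \<open>The difference operator\<close>

lemma Delta_add: "Delta w (f + g) = Delta w f + Delta w g"
  by (simp add: Delta_def pcompose_add smult_diff_right smult_add_right algebra_simps)

lemma Delta_smult: "Delta w (smult c f) = smult c (Delta w f)"
  by (simp add: Delta_def pcompose_smult smult_diff_right mult.commute)

lemma Delta_zero: "Delta w 0 = 0"
  by (simp add: Delta_def)

lemma Delta_pow_add: "(Delta w ^^ i) (f + g) = (Delta w ^^ i) f + (Delta w ^^ i) g"
  by (induction i) (simp_all add: Delta_add)

lemma Delta_pow_smult: "(Delta w ^^ i) (smult c f) = smult c ((Delta w ^^ i) f)"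
  by (induction i) (simp_all add: Delta_smult)

lemma Delta_pow_zero: "(Delta w ^^ i) 0 = 0"
  by (induction i) (simp_all add: Delta_zero)

lemma Delta_pow_diff: "(Delta w ^^ i) (f - g) = (Delta w ^^ i) f - (Delta w ^^ i) g"
  using Delta_pow_add[of i w "f - g" g] by simp

lemma smult_sum_right: "smult c (sum f A) = (\<Sum>a\<in>A. smult c (f a))"
  by (induction A rule: infinite_finite_induct) (simp_all add: smult_add_right)

lemma Delta_pow_sum: "(Delta w ^^ i) (sum f A) = (\<Sum>a\<in>A. (Delta w ^^ i) (f a))"
  by (induction A rule: infinite_finite_induct) (simp_all add: Delta_pow_zero Delta_pow_add)

text \<open>
  A product rule: the shift by \<open>w\<close> acts on the factor \<open>x + c\<close> by adding \<open>w\<close>, and the difference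
  quotient of that factor is \<open>1\<close>. Its iteration below is the commutator of \<open>\<Delta>\<^sub>w\<^sup>k\<close> with
  multiplication by \<open>x\<close>.
\<close>
lemma Delta_linear_mult:
  assumes "w \<noteq> 0"
  shows "Delta w ([:c, 1:] * f) = [:c + w, 1:] * Delta w f + f"
proof -
  have "poly (Delta w ([:c, 1:] * f)) z = poly ([:c + w, 1:] * Delta w f + f) z" for z
    using assms by (simp add: Delta_def poly_pcompose field_simps)
  then show ?thesis by (simp add: poly_eq_poly_eq_iff[symmetric] fun_eq_iff)
qed

lemma Delta_pow_linear_mult:
  assumes "w \<noteq> 0"
  shows "(Delta w ^^ Suc m) ([:c, 1:] * f) =
    [:c + of_nat (Suc m) * w, 1:] * (Delta w ^^ Suc m) f + smult (of_nat (Suc m)) ((Delta w ^^ m) f)"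
proof (induction m)
  case 0
  show ?case using Delta_linear_mult[OF assms, of c f] by simp
next
  case (Suc m)
  have "(Delta w ^^ Suc (Suc m)) ([:c, 1:] * f) = Delta w ((Delta w ^^ Suc m) ([:c, 1:] * f))"
    by simp
  also have "\<dots> = [:c + of_nat (Suc m) * w + w, 1:] * Delta w ((Delta w ^^ Suc m) f)
      + (Delta w ^^ Suc m) f + smult (of_nat (Suc m)) ((Delta w ^^ Suc m) f)"
    unfolding Suc.IH Delta_add Delta_smult Delta_linear_mult[OF assms] by simp
  also have "\<dots> = [:c + of_nat (Suc (Suc m)) * w, 1:] * (Delta w ^^ Suc (Suc m)) f
      + smult (of_nat (Suc (Suc m))) ((Delta w ^^ Suc m) f)"
    unfolding of_nat_Suc[of "Suc m"] smult_add_left by (simp add: algebra_simps)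
  finally show ?case .
qed

section \<open>The operator \<open>1 + \<alpha> \<Delta>\<^sub>w\<close>\<close>

definition one_plus_Delta :: "complex \<Rightarrow> complex \<Rightarrow> complex poly \<Rightarrow> complex poly" where
  "one_plus_Delta w \<alpha> f = f + smult \<alpha> (Delta w f)"

lemma one_plus_Delta_pow_add: "(one_plus_Delta w \<alpha> ^^ m) (f + g) = (one_plus_Delta w \<alpha> ^^ m) f + (one_plus_Delta w \<alpha> ^^ m) g"
  by (induction m) (simp_all add: one_plus_Delta_def Delta_add smult_add_right)

lemma one_plus_Delta_pow_smult: "(one_plus_Delta w \<alpha> ^^ m) (smult c f) = smult c ((one_plus_Delta w \<alpha> ^^ m) f)"
  by (induction m) (simp_all add: one_plus_Delta_def Delta_smult smult_add_right mult.commute)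

lemma one_plus_Delta_pow_Delta: "(one_plus_Delta w \<alpha> ^^ m) (Delta w f) = Delta w ((one_plus_Delta w \<alpha> ^^ m) f)"
  by (induction m) (simp_all add: one_plus_Delta_def Delta_add Delta_smult)

lemma one_plus_Delta_pow_expand:
  "(one_plus_Delta w \<alpha> ^^ m) f = (\<Sum>i\<le>m. smult (of_nat (m choose i) * \<alpha> ^ i) ((Delta w ^^ i) f))"
proof (induction m)
  case 0
  show ?case by simp
next
  case (Suc m)
  let ?a = "\<lambda>m i. smult (of_nat (m choose i) * \<alpha> ^ i) ((Delta w ^^ i) f)"
  have D: "smult \<alpha> (Delta w (\<Sum>i\<le>m. ?a m i)) =
      (\<Sum>i\<le>m. smult (of_nat (m choose i) * \<alpha> ^ Suc i) ((Delta w ^^ Suc i) f))"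
    using Delta_pow_sum[of 1 w "?a m" "{..m}"]
    by (simp add: Delta_smult smult_sum_right mult_ac)
  have "(\<Sum>i\<le>Suc m. ?a (Suc m) i) = f + (\<Sum>i\<le>m. ?a (Suc m) (Suc i))"
    by (simp add: sum.atMost_Suc_shift del: sum.atMost_Suc)
  also have "\<dots> = f + (\<Sum>i\<le>m. ?a m (Suc i))
      + (\<Sum>i\<le>m. smult (of_nat (m choose i) * \<alpha> ^ Suc i) ((Delta w ^^ Suc i) f))"
    by (simp add: sum.distrib[symmetric] smult_add_left[symmetric] algebra_simps)
  also have "f + (\<Sum>i\<le>m. ?a m (Suc i)) = (\<Sum>i\<le>Suc m. ?a m i)"
    by (simp add: sum.atMost_Suc_shift del: sum.atMost_Suc)
  also have "\<dots> = (\<Sum>i\<le>m. ?a m i)" by simp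
  finally have "(\<Sum>i\<le>Suc m. ?a (Suc m) i) = one_plus_Delta w \<alpha> (\<Sum>i\<le>m. ?a m i)"
    unfolding one_plus_Delta_def D .
  then show ?case
    by (simp only: funpow.simps(2) o_apply Suc.IH)
qed

text \<open>
  Each step of the telescoping sum is \<open>T\<^bsup>i+1\<^esup> f - T\<^sup>i f = \<alpha> T\<^sup>i \<Delta>\<^sub>w f\<close>.
\<close>
lemma one_plus_Delta_pow_telescope:
  "(one_plus_Delta w \<alpha> ^^ m) f = f + smult \<alpha> (\<Sum>i<m. (one_plus_Delta w \<alpha> ^^ i) (Delta w f))"
  by (induction m) (simp_all add: one_plus_Delta_pow_Delta smult_add_right, simp add: one_plus_Delta_def)

section \<open>Falling factorials\<close>

lemma falling_factorial_Suc:
  "falling_factorial n (Suc k) = falling_factorial n k * (of_nat n - of_nat k)"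
  by (simp add: falling_factorial_def)

lemma falling_factorial_Suc_Suc:
  "falling_factorial (Suc n) (Suc k) = of_nat (Suc n) * falling_factorial n k"
  by (simp add: falling_factorial_def prod.lessThan_Suc_shift del: prod.lessThan_Suc)

text \<open>
  The products over the first \<open>a\<close> and the last \<open>c\<close> factors are separated; this is how the
  denominator \<open>\<langle>n\<rangle>\<^sub>k\<close> turns into \<open>\<langle>n\<rangle>\<^bsub>j+1\<^esub>\<close> for the \<open>\<gamma>\<close>-terms.
\<close>
lemma falling_factorial_add:
  "falling_factorial (a + b) (a + c) = falling_factorial (a + b) a * falling_factorial b c"
  by (induction c) (simp_all add: falling_factorial_Suc, simp add: falling_factorial_def)

lemma falling_factorial_nonzero: "k \<le> n \<Longrightarrow> falling_factorial n k \<noteq> 0"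
  by (auto simp: falling_factorial_def)

section \<open>Sequences whose differences are \<open>\<Delta>\<^sub>w P\<^bsub>m+1\<^esub> = (m + 1) (1 + \<alpha> \<Delta>\<^sub>w) P\<^sub>m\<close>\<close>

text \<open>
  Read in terms of \<open>P\<close>, the hypothesis is
  \<open>P\<^sub>m = \<Delta>\<^sub>w P\<^bsub>m+1\<^esub> / (m + 1) - \<alpha> \<Delta>\<^sub>w P\<^sub>m\<close>, because the factor \<open>m\<close> cancels the normalisation of
  \<open>Q\<^bsub>m-1\<^esub>\<close>. For \<open>m = 0\<close>, where \<open>Q\<^sub>-\<^sub>1 = 0\<close>, this uses that \<open>P\<^sub>0\<close> is constant.
\<close>
lemma Delta_Suc_of_Q_seq:
  assumes "\<And>m. P m = Q_seq w P m
            - smult (of_nat m * \<alpha>) (zero_ext (Q_seq w P) (int m - 1))"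
    and "P 0 = 1"
  shows "Delta w (P (Suc m)) = smult (of_nat (Suc m)) (one_plus_Delta w \<alpha> (P m))"
proof -
  have eq: "P m = smult (1 / of_nat (Suc m)) (Delta w (P (Suc m))) - smult \<alpha> (Delta w (P m))"
  proof (cases m)
    case 0
    have "Delta w (P 0) = 0" using assms(2) by (simp add: Delta_def pcompose_1)
    then show ?thesis using assms(1)[of 0] 0 by (simp add: Q_seq_def)
  next
    case (Suc l)
    have "of_nat (Suc l) * \<alpha> * (1 / of_nat (Suc l)) = \<alpha>"
      by (simp del: of_nat_Suc)
    moreover have "zero_ext (Q_seq w P) (int m - 1) = Q_seq w P l"
      using Suc by (simp add: zero_ext_def)
    ultimately show ?thesis using assms(1)[of m] Suc
      by (simp add: Q_seq_def del: of_nat_Suc)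
  qed
  have "one_plus_Delta w \<alpha> (P m) = smult (1 / of_nat (Suc m)) (Delta w (P (Suc m)))"
    unfolding one_plus_Delta_def by (subst (1) eq) (simp del: of_nat_Suc)
  then show ?thesis by (simp del: of_nat_Suc)
qed

text \<open>
  Each difference lowers the index by one at the price of one factor \<open>T\<close>, which can be moved past the
  remaining differences because it is a polynomial in \<open>\<Delta>\<^sub>w\<close>.
\<close>
lemma Delta_pow_sequence:
  assumes "\<And>m. Delta w (P (Suc m)) = smult (of_nat (Suc m)) (one_plus_Delta w \<alpha> (P m))"
  shows "(Delta w ^^ k) (P (N + k)) = smult (falling_factorial (N + k) k) ((one_plus_Delta w \<alpha> ^^ k) (P N))"
proof (induction k)
  case 0
  show ?case by (simp add: falling_factorial_def)
next
  case (Suc k)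
  have "(Delta w ^^ Suc k) (P (N + Suc k)) = (Delta w ^^ k) (Delta w (P (Suc (N + k))))"
    by (simp only: funpow_Suc_right o_apply add_Suc_right)
  also have "\<dots> = smult (of_nat (Suc (N + k))) (one_plus_Delta w \<alpha> ((Delta w ^^ k) (P (N + k))))"
    unfolding assms
    by (simp add: Delta_pow_smult one_plus_Delta_def Delta_pow_add funpow_swap1 del: of_nat_Suc)
  also have "\<dots> = smult (falling_factorial (N + Suc k) (Suc k)) ((one_plus_Delta w \<alpha> ^^ Suc k) (P N))"
    using one_plus_Delta_pow_smult[where m = 1]
    by (simp add: Suc.IH falling_factorial_Suc_Suc del: of_nat_Suc)
  finally show ?case .
qed

text \<open>
  The operator \<open>\<Delta>\<^sub>w\<^sup>k\<close> is applied to the recurrence, with an arbitrary remainder \<open>R\<close>. The term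
  \<open>k \<Delta>\<^sub>w\<^bsup>k-1\<^esup> P\<^bsub>N+k\<^esub>\<close> from the commutator is a multiple of \<open>T\<^bsup>k-1\<^esup> P\<^bsub>N+1\<^esub>\<close>, which differs from
  \<open>T\<^sup>k P\<^bsub>N+1\<^esub>\<close> by \<open>\<alpha> T\<^bsup>k-1\<^esup> \<Delta>\<^sub>w P\<^bsub>N+1\<^esub> = (N + 1) \<alpha> T\<^sup>k P\<^sub>N\<close>. Hence only \<open>T\<^sup>k\<close> survives, and the
  correction appears as \<open>- k \<alpha>\<close> in the linear factor.
\<close>
lemma differenced_recurrence:
  assumes w: "w \<noteq> 0"
    and D: "\<And>m. Delta w (P (Suc m)) = smult (of_nat (Suc m)) (one_plus_Delta w \<alpha> (P m))"
    and rec: "P (Suc (N + k)) = [:- b, 1:] * P (N + k) - R"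
  shows "(one_plus_Delta w \<alpha> ^^ k) (P (Suc N)) =
    [:of_nat k * w - of_nat k * \<alpha> - b, 1:] * (one_plus_Delta w \<alpha> ^^ k) (P N)
    - smult (1 / falling_factorial (N + k) k) ((Delta w ^^ k) R)"
proof (cases k)
  case 0
  then show ?thesis using rec by (simp add: falling_factorial_def)
next
  case (Suc m)
  let ?T = "one_plus_Delta w \<alpha>" and ?n = "N + k"
  define F where "F = falling_factorial ?n m"
  have F: "falling_factorial ?n k = F * of_nat (Suc N)"
    unfolding F_def Suc by (simp add: falling_factorial_Suc)
  have F': "falling_factorial (Suc ?n) k = of_nat (Suc ?n) * F"
    unfolding F_def Suc by (rule falling_factorial_Suc_Suc)
  have nz: "F \<noteq> 0" unfolding F_def Suc by (rule falling_factorial_nonzero) simp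
  have 1: "(Delta w ^^ k) (P (Suc ?n)) = smult (of_nat (Suc ?n) * F) ((?T ^^ k) (P (Suc N)))"
    using Delta_pow_sequence[of w P \<alpha> k "Suc N", OF D] F' by simp
  have 2: "(Delta w ^^ k) (P ?n) = smult (F * of_nat (Suc N)) ((?T ^^ k) (P N))"
    using Delta_pow_sequence[of w P \<alpha> k N, OF D] F by simp
  have 3: "(Delta w ^^ m) (P ?n) = smult F ((?T ^^ m) (P (Suc N)))"
    using Delta_pow_sequence[of w P \<alpha> m "Suc N", OF D] Suc by (simp add: F_def)
  \<comment> \<open>This expresses \<open>T\<^bsup>k-1\<^esup> P\<^bsub>N+1\<^esub>\<close> through \<open>k\<close>-th powers of \<open>T\<close>.\<close>
  have 4: "(?T ^^ m) (P (Suc N)) =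
      (?T ^^ k) (P (Suc N)) - smult (\<alpha> * of_nat (Suc N)) ((?T ^^ k) (P N))"
  proof -
    have "(?T ^^ k) (P (Suc N)) = (?T ^^ m) (P (Suc N) + smult \<alpha> (Delta w (P (Suc N))))"
      unfolding Suc funpow_Suc_right o_apply one_plus_Delta_def[of w \<alpha> "P (Suc N)"] ..
    also have "\<dots> = (?T ^^ m) (P (Suc N)) + smult (\<alpha> * of_nat (Suc N)) ((?T ^^ k) (P N))"
      unfolding D one_plus_Delta_pow_add one_plus_Delta_pow_smult Suc funpow_Suc_right o_apply by simp
    finally show ?thesis by simp
  qed
  have 5: "(Delta w ^^ k) (P (Suc ?n)) =
      [:- b + of_nat k * w, 1:] * (Delta w ^^ k) (P ?n) + smult (of_nat k) ((Delta w ^^ m) (P ?n))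
      - (Delta w ^^ k) R"
    unfolding rec Delta_pow_diff unfolding Suc Delta_pow_linear_mult[OF w] ..
  have "poly ((?T ^^ k) (P (Suc N))) z = poly ([:of_nat k * w - of_nat k * \<alpha> - b, 1:] * (?T ^^ k) (P N)
    - smult (1 / falling_factorial ?n k) ((Delta w ^^ k) R)) z" for z
  proof -
    define A B C where "A = poly ((?T ^^ k) (P (Suc N))) z" and "B = poly ((?T ^^ k) (P N)) z"
      and "C = poly ((Delta w ^^ k) R) z"
    define M where "M = (of_nat (Suc N) :: complex)"
    have M0: "M \<noteq> 0" unfolding M_def by (simp del: of_nat_Suc)
    have Mk: "of_nat (Suc ?n) = M + of_nat k" unfolding M_def by simp
    \<comment> \<open>The part \<open>k F A\<close> occurs on both sides; its cancellation leaves \<open>\<langle>n\<rangle>\<^sub>k = F M\<close> as the common factor.\<close>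
    have "(M + of_nat k) * F * A =
        (z - b + of_nat k * w) * (F * M * B) + of_nat k * (F * (A - \<alpha> * M * B)) - C"
      using arg_cong[OF 5, of "\<lambda>p. poly p z"] unfolding 1 2 3 4 Mk M_def[symmetric]
      by (simp add: A_def B_def C_def algebra_simps)
    then have "F * M * A = F * M * ((z + of_nat k * w - of_nat k * \<alpha> - b) * B) - C"
      by (simp add: algebra_simps)
    then have "A = (z + of_nat k * w - of_nat k * \<alpha> - b) * B - C / (F * M)"
      using nz M0 by (simp add: field_simps)
    then show ?thesis unfolding F M_def A_def B_def C_def by (simp add: algebra_simps)
  qed
  then show ?thesis by (simp add: poly_eq_poly_eq_iff[symmetric] fun_eq_iff)
qed

text \<open>
  Of the \<open>k\<close> differences, \<open>k - 1 - j\<close> lower the index to \<open>N\<close>, and \<open>j + 1\<close> remain.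
\<close>
lemma Delta_pow_remainder_term:
  assumes D: "\<And>m. Delta w (P (Suc m)) = smult (of_nat (Suc m)) (one_plus_Delta w \<alpha> (P m))"
    and j: "j < k"
  shows "smult (1 / falling_factorial (N + k) k) ((Delta w ^^ k) (P (N + k - 1 - j))) =
    smult (1 / falling_factorial (N + k) (j + 1)) ((Delta w ^^ (j + 1)) ((one_plus_Delta w \<alpha> ^^ (k - 1 - j)) (P N)))"
proof -
  define l where "l = k - 1 - j"
  have k: "k = (j + 1) + l" using j by (simp add: l_def)
  have ff: "falling_factorial (N + k) k = falling_factorial (N + k) (j + 1) * falling_factorial (N + l) l"
    using falling_factorial_add[of "j + 1" "N + l" l] by (simp add: k add_ac)
  have nz: "falling_factorial (N + l) l \<noteq> 0" by (rule falling_factorial_nonzero) simp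
  have "(Delta w ^^ k) (P (N + k - 1 - j)) = (Delta w ^^ (j + 1)) ((Delta w ^^ l) (P (N + l)))"
    unfolding k by (simp add: funpow_add)
  also have "\<dots> = smult (falling_factorial (N + l) l) ((Delta w ^^ (j + 1)) ((one_plus_Delta w \<alpha> ^^ l) (P N)))"
    unfolding Delta_pow_sequence[of w P \<alpha> l N, OF D] by (rule Delta_pow_smult)
  finally show ?thesis using nz by (simp add: ff l_def)
qed

text \<open>
  After the binomial expansion of \<open>T\<^bsup>k-1-j\<^esup>\<close>, the terms are collected by the total order
  \<open>i = j + 1 + l\<close> of the difference, where \<open>l\<close> is the index of the expansion; the double sum runs
  over the triangle \<open>j < i \<le> k\<close>.
\<close>
lemma sum_Delta_pow_regroup:
  "(\<Sum>j<k. c j * poly ((Delta w ^^ (j + 1)) ((one_plus_Delta w \<alpha> ^^ (k - 1 - j)) f)) x) =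
   (\<Sum>i = 1..k. (\<Sum>j<i. of_nat ((k - 1 - j) choose (i - 1 - j)) * \<alpha> ^ (i - 1 - j) * c j)
      * poly ((Delta w ^^ i) f) x)"
proof -
  let ?g = "\<lambda>j i. of_nat ((k - 1 - j) choose (i - 1 - j)) * \<alpha> ^ (i - 1 - j) * c j
    * poly ((Delta w ^^ i) f) x"
  have inner: "c j * poly ((Delta w ^^ (j + 1)) ((one_plus_Delta w \<alpha> ^^ (k - 1 - j)) f)) x = (\<Sum>i = Suc j..k. ?g j i)"
    if "j < k" for j
  proof -
    have "c j * poly ((Delta w ^^ (j + 1)) ((one_plus_Delta w \<alpha> ^^ (k - 1 - j)) f)) x =
        (\<Sum>l\<le>k - 1 - j. of_nat ((k - 1 - j) choose l) * \<alpha> ^ l * c j * poly ((Delta w ^^ (j + 1 + l)) f) x)"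
      unfolding one_plus_Delta_pow_expand Delta_pow_sum Delta_pow_smult funpow_add o_apply
      by (simp add: poly_sum sum_distrib_left mult_ac)
    also have "\<dots> = (\<Sum>i = Suc j..k. ?g j i)"
      by (rule sum.reindex_bij_witness[of _ "\<lambda>i. i - Suc j" "\<lambda>l. l + Suc j"]) (use that in \<open>auto simp: add_ac\<close>)
    finally show ?thesis .
  qed
  have "(\<Sum>j<k. \<Sum>i = Suc j..k. ?g j i) = (\<Sum>i = 1..k. \<Sum>j<i. ?g j i)"
    unfolding sum.Sigma[OF finite_lessThan, OF ballI[OF finite_atLeastAtMost]]
      sum.Sigma[OF finite_atLeastAtMost, OF ballI[OF finite_lessThan]]
    by (rule sum.reindex_bij_witness[of _ prod.swap prod.swap]) auto
  then show ?thesis using inner by (simp add: sum_distrib_right)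
qed

text \<open>
  The coefficient of \<open>\<Delta>\<^sub>w\<^sup>i f\<close> in \<open>T + \<dots> + T\<^sup>k\<close> is a hockey-stick sum, \<open>\<alpha>\<^sup>i\<close> times
  \<open>k + 1 choose i + 1\<close> for \<open>i \<ge> 1\<close> but only \<open>k\<close> for \<open>i = 0\<close>, because the summand \<open>T\<^sup>0\<close> is absent;
  so \<open>i = 0\<close> is kept apart. For \<open>i \<ge> 1\<close> the factor \<open>- k \<alpha>\<close> is moved from \<open>k choose i\<close> to
  \<open>k + 1 choose i + 1\<close> by the absorption identity
  \<open>(k + 1) (k choose i) = (i + 1) (k + 1 choose i + 1)\<close>.
\<close>
lemma one_plus_Delta_pow_coefficients:
  fixes y \<alpha> :: complex
  shows "(y - of_nat k * \<alpha>) * poly ((one_plus_Delta w \<alpha> ^^ k) f) x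
    - of_nat (Suc N) * \<alpha> * (\<Sum>m = 1..k. poly ((one_plus_Delta w \<alpha> ^^ m) f) x) =
    (y - of_nat k * \<alpha> * of_nat (N + 2)) * poly f x
    + (\<Sum>i = 1..k. \<alpha> ^ i * (of_nat (k choose i) * (y + \<alpha>)
        - \<alpha> * of_nat ((k + 1) choose (i + 1)) * of_nat (N + i + 2)) * poly ((Delta w ^^ i) f) x)"
proof -
  let ?p = "\<lambda>i. poly ((Delta w ^^ i) f) x"
  have ex: "poly ((one_plus_Delta w \<alpha> ^^ m) f) x = poly f x + (\<Sum>i = 1..k. of_nat (m choose i) * \<alpha> ^ i * ?p i)"
    if "m \<le> k" for m
  proof -
    have "poly ((one_plus_Delta w \<alpha> ^^ m) f) x = (\<Sum>i\<le>m. of_nat (m choose i) * \<alpha> ^ i * ?p i)"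
      by (simp add: one_plus_Delta_pow_expand poly_sum)
    also have "\<dots> = (\<Sum>i\<le>k. of_nat (m choose i) * \<alpha> ^ i * ?p i)"
      by (rule sum.mono_neutral_left) (use that in auto)
    also have "\<dots> = poly f x + (\<Sum>i = 1..k. of_nat (m choose i) * \<alpha> ^ i * ?p i)"
      by (simp add: atMost_atLeast0 sum.atLeast_Suc_atMost)
    finally show ?thesis .
  qed
  have hockey: "(\<Sum>m = 1..k. of_nat (m choose i)) = (of_nat ((k + 1) choose (i + 1)) :: complex)"
    if "1 \<le> i" for i
    using that by (induction k) (simp_all add: add.commute)
  have S: "(\<Sum>m = 1..k. poly ((one_plus_Delta w \<alpha> ^^ m) f) x) =
      of_nat k * poly f x + (\<Sum>i = 1..k. of_nat ((k + 1) choose (i + 1)) * \<alpha> ^ i * ?p i)"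
  proof -
    have "(\<Sum>m = 1..k. poly ((one_plus_Delta w \<alpha> ^^ m) f) x) =
        (\<Sum>m = 1..k. poly f x + (\<Sum>i = 1..k. of_nat (m choose i) * \<alpha> ^ i * ?p i))"
      by (intro sum.cong refl ex) simp
    also have "\<dots> = of_nat k * poly f x + (\<Sum>i = 1..k. \<Sum>m = 1..k. of_nat (m choose i) * \<alpha> ^ i * ?p i)"
      by (simp add: sum.distrib) (rule sum.swap)
    also have "(\<Sum>i = 1..k. \<Sum>m = 1..k. of_nat (m choose i) * \<alpha> ^ i * ?p i) =
        (\<Sum>i = 1..k. of_nat ((k + 1) choose (i + 1)) * \<alpha> ^ i * ?p i)"
      by (intro sum.cong refl) (simp only: sum_distrib_right[symmetric] hockey atLeastAtMost_iff)
    finally show ?thesis .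
  qed
  have coeff: "(y - of_nat k * \<alpha>) * (of_nat (k choose i) * \<alpha> ^ i * ?p i)
      - of_nat (Suc N) * \<alpha> * (of_nat ((k + 1) choose (i + 1)) * \<alpha> ^ i * ?p i) =
      \<alpha> ^ i * (of_nat (k choose i) * (y + \<alpha>)
        - \<alpha> * of_nat ((k + 1) choose (i + 1)) * of_nat (N + i + 2)) * ?p i" for i
  proof -
    define b where "b = (of_nat ((k + 1) choose (i + 1)) :: complex)"
    define c where "c = (of_nat (k choose i) :: complex)"
    have "(of_nat i + 1) * b = (of_nat k + 1) * c"
      using arg_cong[OF Suc_times_binomial[of i k], of "of_nat :: nat \<Rightarrow> complex"]
      unfolding b_def c_def of_nat_mult by (simp add: add.commute)
    then have "of_nat k * c = of_nat i * b + b - c" by (simp add: algebra_simps)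
    then have "(y - of_nat k * \<alpha>) * c - of_nat (Suc N) * \<alpha> * b = c * (y + \<alpha>) - \<alpha> * b * of_nat (N + i + 2)"
      by (simp add: algebra_simps) (metis (no_types, opaque_lifting) mult.left_commute distrib_left mult.commute)
    then have "(y - of_nat k * \<alpha>) * (c * a * q) - of_nat (Suc N) * \<alpha> * (b * a * q) =
        a * (c * (y + \<alpha>) - \<alpha> * b * of_nat (N + i + 2)) * q" for a q
      by algebra
    then show ?thesis unfolding b_def c_def .
  qed
  have "(y - of_nat k * \<alpha>) * poly ((one_plus_Delta w \<alpha> ^^ k) f) x
      - of_nat (Suc N) * \<alpha> * (\<Sum>m = 1..k. poly ((one_plus_Delta w \<alpha> ^^ m) f) x) =
      (y - of_nat k * \<alpha> - of_nat (Suc N) * \<alpha> * of_nat k) * poly f x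
      + (\<Sum>i = 1..k. (y - of_nat k * \<alpha>) * (of_nat (k choose i) * \<alpha> ^ i * ?p i)
      - of_nat (Suc N) * \<alpha> * (of_nat ((k + 1) choose (i + 1)) * \<alpha> ^ i * ?p i))"
    unfolding S ex[OF order_refl] sum_subtractf sum_distrib_left[symmetric]
    by (simp add: algebra_simps del: binomial_Suc_Suc)
  also have "y - of_nat k * \<alpha> - of_nat (Suc N) * \<alpha> * of_nat k = y - of_nat k * \<alpha> * of_nat (N + 2)"
    by (simp add: algebra_simps)
  finally show ?thesis unfolding coeff .
qed

theorem theorem3p5:
  fixes d n k :: nat and w \<alpha> x :: complex
    and P :: "nat \<Rightarrow> complex poly"
    and \<beta> :: "nat \<Rightarrow> complex" and \<gamma> :: "int \<Rightarrow> nat \<Rightarrow> complex"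
  assumes "d \<ge> 1" and "w \<noteq> 0"
    and "monic_sequence P" and "d_orthogonal d P"
    and "\<And>m. P m = Q_seq w P m
            - smult (of_nat m * \<alpha>) (zero_ext (Q_seq w P) (int m - 1))"
    and "recurrence_coeffs d P \<beta> \<gamma>"
    and "k \<le> d" and "k \<le> n"
  shows "poly (P (n - k + 1)) x =
      (x + of_nat k * w - of_nat k * \<alpha> * of_nat (n - k + 2) - \<beta> n) * poly (P (n - k)) x
    + (\<Sum>i = 1..k.
        (\<alpha> ^ i * (of_nat (k choose i) * (x + of_nat k * w + \<alpha> - \<beta> n)
                 - \<alpha> * of_nat ((k + 1) choose (i + 1)) * of_nat (n - k + i + 2))
         - (\<Sum>j<i. of_nat ((k - 1 - j) choose (i - 1 - j)) * \<alpha> ^ (i - 1 - j)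
                   * (\<gamma> (int n - int j) (d - 1 - j) / falling_factorial n (j + 1))))
        * poly ((Delta w ^^ i) (P (n - k))) x)
    - (\<Sum>i = k..<d. \<gamma> (int n - int i) (d - 1 - i) / falling_factorial n k
        * poly ((Delta w ^^ k) (zero_ext P (int n - int i - 1))) x)"
proof -
  let ?T = "one_plus_Delta w \<alpha>"
  define N where "N = n - k"
  have n: "n = N + k" using \<open>k \<le> n\<close> by (simp add: N_def)
  have P0: "P 0 = 1"
    and rec: "P (Suc n) = [:- \<beta> n, 1:] * P n
        - (\<Sum>j<d. smult (\<gamma> (int n - int j) (d - 1 - j)) (zero_ext P (int n - 1 - int j)))"
    using assms(6) by (auto simp: recurrence_coeffs_def)
  have D: "Delta w (P (Suc m)) = smult (of_nat (Suc m)) (?T (P m))" for m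
    by (rule Delta_Suc_of_Q_seq[OF assms(5) P0])
  define t where "t = (\<lambda>j. \<gamma> (int n - int j) (d - 1 - j) / falling_factorial n k
      * poly ((Delta w ^^ k) (zero_ext P (int n - int j - 1))) x)"
  have high: "poly ((?T ^^ k) (P (Suc N))) x =
      (x + of_nat k * w - \<beta> n - of_nat k * \<alpha>) * poly ((?T ^^ k) (P N)) x - (\<Sum>j<d. t j)"
  proof -
    have rem: "poly (smult (1 / falling_factorial n k) ((Delta w ^^ k)
        (\<Sum>j<d. smult (\<gamma> (int n - int j) (d - 1 - j)) (zero_ext P (int n - 1 - int j))))) x
        = (\<Sum>j<d. t j)"
      by (simp add: Delta_pow_sum Delta_pow_smult poly_sum sum_divide_distrib t_def algebra_simps)
    from arg_cong[OF differenced_recurrence[OF \<open>w \<noteq> 0\<close> D rec[unfolded n]], of "\<lambda>p. poly p x"]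
    show ?thesis
      unfolding poly_diff poly_mult rem[unfolded n] n
      by (simp add: algebra_simps)
  qed
  have tele: "poly ((?T ^^ k) (P (Suc N))) x =
      poly (P (Suc N)) x + of_nat (Suc N) * \<alpha> * (\<Sum>m = 1..k. poly ((?T ^^ m) (P N)) x)"
  proof -
    have "(\<Sum>i<k. (?T ^^ i) (Delta w (P (Suc N)))) = smult (of_nat (Suc N)) (\<Sum>i<k. (?T ^^ Suc i) (P N))"
      unfolding D one_plus_Delta_pow_smult funpow_Suc_right o_apply smult_sum_right ..
    also have "(\<Sum>i<k. (?T ^^ Suc i) (P N)) = (\<Sum>m = 1..k. (?T ^^ m) (P N))"
      by (rule sum.reindex_bij_witness[of _ "\<lambda>m. m - 1" Suc]) auto
    finally show ?thesis
      unfolding one_plus_Delta_pow_telescope[of k w \<alpha> "P (Suc N)"] by (simp add: poly_sum mult_ac del: of_nat_Suc)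
  qed
  have "(\<Sum>j<d. t j) = (\<Sum>j<k. t j) + (\<Sum>i = k..<d. t i)"
    using sum.atLeastLessThan_concat[of 0 k d t] \<open>k \<le> d\<close> by (simp add: atLeast0LessThan)
  also have "(\<Sum>j<k. t j) = (\<Sum>j<k. \<gamma> (int n - int j) (d - 1 - j) / falling_factorial n (j + 1)
      * poly ((Delta w ^^ (j + 1)) ((?T ^^ (k - 1 - j)) (P N))) x)"
  proof (rule sum.cong[OF refl])
    fix j assume "j \<in> {..<k}"
    then have j: "j < k" by simp
    \<comment> \<open>Here \<open>j < k \<le> n\<close> keeps the index nonnegative.\<close>
    have "zero_ext P (int n - int j - 1) = P (N + k - 1 - j)"
      using j unfolding n zero_ext_def by (auto intro!: arg_cong[of _ _ P])
    with arg_cong[OF Delta_pow_remainder_term[OF D j, of N], of "\<lambda>p. \<gamma> (int n - int j) (d - 1 - j) * poly p x"]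
    show "t j = \<gamma> (int n - int j) (d - 1 - j) / falling_factorial n (j + 1)
      * poly ((Delta w ^^ (j + 1)) ((?T ^^ (k - 1 - j)) (P N))) x"
      unfolding t_def n by simp
  qed
  also note sum_Delta_pow_regroup
  finally have low: "(\<Sum>j<d. t j) =
      (\<Sum>i = 1..k. (\<Sum>j<i. of_nat ((k - 1 - j) choose (i - 1 - j)) * \<alpha> ^ (i - 1 - j)
          * (\<gamma> (int n - int j) (d - 1 - j) / falling_factorial n (j + 1)))
        * poly ((Delta w ^^ i) (P N)) x)
      + (\<Sum>i = k..<d. t i)" .
  have "poly (P (Suc N)) x = ((x + of_nat k * w - \<beta> n) - of_nat k * \<alpha>) * poly ((?T ^^ k) (P N)) x
      - of_nat (Suc N) * \<alpha> * (\<Sum>m = 1..k. poly ((?T ^^ m) (P N)) x) - (\<Sum>j<d. t j)"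
    using high tele by algebra
  note this[unfolded one_plus_Delta_pow_coefficients low]
  moreover have "x + of_nat k * w - \<beta> n + \<alpha> = x + of_nat k * w + \<alpha> - \<beta> n"
    and "x + of_nat k * w - \<beta> n - of_nat k * \<alpha> * of_nat (N + 2)
      = x + of_nat k * w - of_nat k * \<alpha> * of_nat (N + 2) - \<beta> n"
    by simp_all
  ultimately show ?thesis
    unfolding N_def[symmetric] left_diff_distrib[of _ "sum _ _"] sum_subtractf t_def[symmetric]
    by (simp del: of_nat_add of_nat_Suc binomial_Suc_Suc)
qed

end
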